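(* There exists a randomized algorithm $\mathcal{A}$ such that for every $n$, $m$, $\alpha$, every $\varepsilon\in(0,1)$, and every graph $G=(V,E)$ with $n$ vertices, $m$ edges and arboricity at most $\alpha$, the following holds. Given $n$, $\alpha$ and $\varepsilon$, and query access to $G$ in the uniform vertex sampling model, $\mathcal{A}$ returns an edge $e\in E$ sampled from a distribution $\widehat{U}$ that is pointwise $\varepsilon$-close to uniform over $E$, using $O\!\left(\frac{\alpha}{d}\cdot\frac{\log^3 n}{\varepsilon}\right)$ degree and neighbor queries in expectation, where $d=2m/n$ is the average degree of $G$.
   Context: Uniform vertex sampling model: the vertex set is $V=\{1,\dots,n\}$, the algorithm may select vertices uniformly at random, and it may perform degree queries $\deg(v)$ (returning the degree $d(v)$ of $v$) and neighbor queries $\mathrm{nbr}(v,i)$ (returning the $i$-th neighbor of $v$ under an arbitrary fixed ordering of $v$'s neighbors, or a special symbol $\bot$ if $i>d(v)$). The arboricity of $G$ is the minimum number of spanning forests (acyclic subgraphs on vertex set $V$) whose edge sets cover $E$. A distribution $\widehat{D}$ on a finite set $X$ is pointwise $\varepsilon$-close to a distribution $D$ if $|\widehat{D}(x)-D(x)|\le \varepsilon D(x)$ for all $x\in X$; it is pointwise $\varepsilon$-close to uniform if this holds with $D$ the uniform distribution on $X$. *)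

theory Defs
  imports "HOL-Probability.SPMF"
begin

definition simple_graph :: "nat set \<Rightarrow> nat set set \<Rightarrow> bool" where
  "simple_graph V E \<longleftrightarrow> (\<forall>e\<in>E. e \<subseteq> V \<and> card e = 2)"

definition neighbours :: "nat set set \<Rightarrow> nat \<Rightarrow> nat set" where
  "neighbours E v = {w. {v, w} \<in> E}"

definition degree :: "nat set set \<Rightarrow> nat \<Rightarrow> nat" where
  "degree E v = card (neighbours E v)"

definition is_cycle :: "nat set set \<Rightarrow> nat list \<Rightarrow> bool" where
  "is_cycle E vs \<longleftrightarrow> 3 \<le> length vs \<and> distinct vs \<and>
     (\<forall>i<length vs. {vs ! i, vs ! (Suc i mod length vs)} \<in> E)"

definition acyclic_edges :: "nat set set \<Rightarrow> bool" where
  "acyclic_edges F \<longleftrightarrow> (\<nexists>vs. is_cycle F vs)"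

text \<open>A spanning forest has the full vertex set of the graph, so it is determined by its edge set.\<close>

definition arboricity :: "nat set set \<Rightarrow> nat" where
  "arboricity E = (LEAST k. \<exists>F :: nat \<Rightarrow> nat set set.
     (\<forall>i<k. F i \<subseteq> E \<and> acyclic_edges (F i)) \<and> E \<subseteq> (\<Union>i<k. F i))"

definition neighbour_ordering :: "nat set set \<Rightarrow> (nat \<Rightarrow> nat list) \<Rightarrow> bool" where
  "neighbour_ordering E adj \<longleftrightarrow> (\<forall>v. distinct (adj v) \<and> set (adj v) = neighbours E v)"

text \<open>Neighbours are numbered from 1; \<^term>\<open>None\<close> plays the role of the symbol \<open>\<bottom>\<close>.\<close>

definition nth_neighbour :: "(nat \<Rightarrow> nat list) \<Rightarrow> nat \<Rightarrow> nat \<Rightarrow> nat option" where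
  "nth_neighbour adj v i =
     (if 1 \<le> i \<and> i \<le> length (adj v) then Some (adj v ! (i - 1)) else None)"

text \<open>
  A randomized query algorithm is a possibly infinite interaction tree: each node is either a
  result, or an action together with a continuation that receives the answer.
  \<open>Vertex\<close> asks for a uniformly random vertex, and \<open>Random k\<close> draws a
  uniformly random element of \<open>{0, ..., k - 1}\<close> from the internal randomness of the
  algorithm. The tree has no access to the graph other than through the answers.
\<close>

codatatype 'r query_alg =
    Return 'r
  | Random nat "nat \<Rightarrow> 'r query_alg"
  | Vertex "nat \<Rightarrow> 'r query_alg"
  | Deg nat "nat \<Rightarrow> 'r query_alg"
  | Nbr nat nat "nat option \<Rightarrow> 'r query_alg"

text \<open>
  Joint distribution of the result and the number of degree and neighbour queries made, when
  the algorithm is run on the graph with vertex set \<open>{1, ..., n}\<close>, edge set \<open>E\<close> and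
  neighbour ordering \<open>adj\<close>. The mass missing from 1 is the probability that the run
  does not terminate (or attempts a draw from an empty range).
\<close>

partial_function (spmf) run ::
    "nat \<Rightarrow> nat set set \<Rightarrow> (nat \<Rightarrow> nat list) \<Rightarrow> 'r query_alg \<Rightarrow> ('r \<times> nat) spmf" where
  "run n E adj a = (case a of
      Return r \<Rightarrow> return_spmf (r, 0)
    | Random k f \<Rightarrow> bind_spmf (spmf_of_set {..<k}) (\<lambda>x. run n E adj (f x))
    | Vertex f \<Rightarrow> bind_spmf (spmf_of_set {1..n}) (\<lambda>v. run n E adj (f v))
    | Deg v f \<Rightarrow> map_spmf (apsnd Suc) (run n E adj (f (degree E v)))
    | Nbr v i f \<Rightarrow> map_spmf (apsnd Suc) (run n E adj (f (nth_neighbour adj v i))))"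

definition output_distribution ::
    "nat \<Rightarrow> nat set set \<Rightarrow> (nat \<Rightarrow> nat list) \<Rightarrow> 'r query_alg \<Rightarrow> 'r spmf" where
  "output_distribution n E adj a = map_spmf fst (run n E adj a)"

text \<open>The integral ranges over terminating runs only, so it is the expected number of queries
  for algorithms that terminate almost surely.\<close>

definition expected_queries ::
    "nat \<Rightarrow> nat set set \<Rightarrow> (nat \<Rightarrow> nat list) \<Rightarrow> 'r query_alg \<Rightarrow> ennreal" where
  "expected_queries n E adj a = (\<integral>\<^sup>+ x. of_nat (snd x) \<partial>measure_spmf (run n E adj a))"

definition pointwise_close :: "'a set \<Rightarrow> real \<Rightarrow> 'a pmf \<Rightarrow> 'a pmf \<Rightarrow> bool" where
  "pointwise_close X \<epsilon> D' D \<longleftrightarrow> (\<forall>x\<in>X. \<bar>pmf D' x - pmf D x\<bar> \<le> \<epsilon> * pmf D x)"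

end

theory Submission
  imports Defs
begin

text \<open>
  Call a vertex light if its degree is at most a threshold \<open>t\<close>. An attempt draws a uniform vertex,
  gives up unless it is light, moves to its \<open>i\<close>-th neighbour for a uniform \<open>i \<le> t\<close> (giving up if there is
  none), and then performs \<open>j\<close> further random walk steps, with \<open>j \<le> l\<close> uniform, giving up as soon as a
  light vertex is to be left; the last edge traversed is the result. By reversibility, the attempt
  returns the directed edge \<open>(v, w)\<close> with probability \<open>hit v / ((l + 1) n t)\<close>, where \<open>hit v\<close> is the
  probability that the random walk from \<open>v\<close> meets a light vertex within \<open>l\<close> steps.

  Now peel the heavy vertices: in each round, remove those that have at most a fraction \<open>\<delta>\<close> of their
  neighbours among the surviving ones. A set \<open>S\<close> spans at most \<open>\<alpha> |S|\<close> edges and heavy degrees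
  exceed \<open>t \<ge> 4 \<alpha> / \<delta>\<close>, so at most half of the vertices survive a round, and none survives \<open>l > log n\<close>
  rounds. A vertex removed in round \<open>k\<close> reaches a light one within \<open>k\<close> steps with probability at
  least \<open>1 - k \<delta>\<close>. With \<open>\<delta> = \<epsilon> / (2 l)\<close> all \<open>hit v\<close> lie in \<open>[1 - \<epsilon> / 2, 1]\<close>, so attempts repeated until
  one succeeds give a distribution close to uniform. An attempt costs at most \<open>2 l + 2\<close> queries and
  \<open>O(n t l / m)\<close> attempts are expected.
\<close>

section \<open>Arboricity\<close>

text \<open>Take a longest path inside \<open>S\<close>. All neighbours in \<open>S\<close> of its
  first vertex lie on the path, and any of them other than the second vertex of the path would close
  a cycle.\<close>

lemma acyclic_low_degree:
  assumes acyclic: "acyclic_edges F" and edges: "\<And>e. e \<in> F \<Longrightarrow> card e = 2"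
    and fin: "finite S" and "S \<noteq> {}"
  shows "\<exists>x\<in>S. card (neighbours F x \<inter> S) \<le> 1"
proof (rule ccontr)
  assume "\<not> ?thesis"
  hence deg: "2 \<le> card (neighbours F x \<inter> S)" if "x \<in> S" for x
    using that by (metis not_less_eq_eq numeral_2_eq_2 One_nat_def)
  define path where "path vs \<longleftrightarrow> vs \<noteq> [] \<and> distinct vs \<and> set vs \<subseteq> S \<and>
    (\<forall>i. Suc i < length vs \<longrightarrow> {vs ! i, vs ! Suc i} \<in> F)" for vs
  obtain x0 where "x0 \<in> S" using \<open>S \<noteq> {}\<close> by blast
  hence "path [x0]" by (simp add: path_def)
  moreover have "length vs \<le> card S" if "path vs" for vs
    using that card_mono[OF fin, of "set vs"] by (simp add: path_def distinct_card)
  ultimately obtain vs where vs: "path vs" and longest: "\<And>us. path us \<Longrightarrow> length us \<le> length vs"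
    using ex_has_greatest_nat[of path "[x0]" length "Suc (card S)"]
    by (metis less_Suc_eq_le)
  have "vs ! 0 \<in> S" using vs nth_mem[of 0 vs] by (auto simp: path_def)
  \<comment> \<open>For a one-vertex path \<open>vs ! 1\<close> is an unspecified value; it can
    still be avoided, since there are two neighbours to choose from.\<close>
  have "\<not> neighbours F (vs ! 0) \<inter> S \<subseteq> {vs ! 1}"
    using deg[OF \<open>vs ! 0 \<in> S\<close>] card_mono[of "{vs ! 1}" "neighbours F (vs ! 0) \<inter> S"] by auto
  then obtain w where w: "{vs ! 0, w} \<in> F" "w \<in> S" "w \<noteq> vs ! 1"
    by (auto simp: neighbours_def)
  have "w \<in> set vs"
  proof (rule ccontr)
    assume "w \<notin> set vs"
    moreover have "{(w # vs) ! i, (w # vs) ! Suc i} \<in> F" if "Suc i < length (w # vs)" for i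
      using that vs w(1) by (cases i) (simp_all add: path_def insert_commute)
    ultimately have "path (w # vs)"
      using vs w(2) by (simp add: path_def)
    thus False using longest[of "w # vs"] by simp
  qed
  then obtain i where i: "i < length vs" "w = vs ! i" by (auto simp: in_set_conv_nth)
  have "i \<noteq> 0"
  proof
    assume "i = 0"
    thus False using edges[OF w(1)] i(2) by simp
  qed
  moreover have "i \<noteq> 1" using w(3) i(2) by auto
  ultimately have "2 \<le> i" by linarith
  have "is_cycle F (take (Suc i) vs)"
    unfolding is_cycle_def
  proof (intro conjI allI impI)
    fix k assume "k < length (take (Suc i) vs)"
    hence k: "k \<le> i" using i by simp
    show "{take (Suc i) vs ! k, take (Suc i) vs ! (Suc k mod length (take (Suc i) vs))} \<in> F"
    proof (cases "k = i")
      case True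
      thus ?thesis using w i by (simp add: insert_commute)
    next
      case False
      thus ?thesis using k i vs by (simp add: path_def)
    qed
  qed (use \<open>2 \<le> i\<close> i(1) vs in \<open>simp_all add: path_def\<close>)
  thus False using acyclic by (auto simp: acyclic_edges_def)
qed

text \<open>Deleting a vertex with at most one neighbour in \<open>S\<close> removes at most two
  ordered pairs. Every edge is counted in both orientations, hence the factor 2.\<close>

lemma card_acyclic_pairs_le:
  assumes "acyclic_edges F" "\<And>e. e \<in> F \<Longrightarrow> card e = 2" "finite S"
  shows "card {(v, w) \<in> S \<times> S. {v, w} \<in> F} \<le> 2 * card S"
  using \<open>finite S\<close>
proof (induction S rule: finite_psubset_induct)
  case (psubset S)
  show ?case
  proof (cases "S = {}")
    case False
    then obtain x where x: "x \<in> S" and deg: "card (neighbours F x \<inter> S) \<le> 1"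
      using acyclic_low_degree[OF assms(1,2) psubset.hyps(1)] by blast
    let ?N = "neighbours F x \<inter> S" and ?P = "{(v, w) \<in> (S - {x}) \<times> (S - {x}). {v, w} \<in> F}"
    have fin: "finite (?N)" "finite ?P"
      using psubset.hyps(1) by (auto intro: finite_subset[of _ "S \<times> S"])
    have "{(v, w) \<in> S \<times> S. {v, w} \<in> F} \<subseteq> ?P \<union> ({x} \<times> ?N \<union> ?N \<times> {x})"
      by (auto simp: neighbours_def insert_commute)
    hence "card {(v, w) \<in> S \<times> S. {v, w} \<in> F} \<le> card (?P \<union> ({x} \<times> ?N \<union> ?N \<times> {x}))"
      using fin by (intro card_mono) auto
    also have "\<dots> \<le> card ?P + (card ({x} \<times> ?N) + card (?N \<times> {x}))"
      by (intro order.trans[OF card_Un_le] add_left_mono card_Un_le)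
    also have "\<dots> \<le> 2 * card (S - {x}) + 2"
    proof -
      have "card ?P \<le> 2 * card (S - {x})" using x by (intro psubset.IH) auto
      thus ?thesis using deg by (simp add: card_cartesian_product)
    qed
    also have "\<dots> = 2 * card S"
      using x psubset.hyps(1) card_Suc_Diff1[of S x] by simp
    finally show ?thesis .
  qed simp
qed

lemma acyclic_edges_singleton: "acyclic_edges {e}"
  unfolding acyclic_edges_def
proof
  assume "\<exists>vs. is_cycle {e} vs"
  then obtain vs where vs: "3 \<le> length vs" "distinct vs"
    "\<And>i. i < length vs \<Longrightarrow> {vs ! i, vs ! (Suc i mod length vs)} = e"
    by (auto simp: is_cycle_def)
  have "{vs ! 0, vs ! 1} = {vs ! 1, vs ! 2}"
  proof -
    have "0 < length vs" "1 < length vs" "Suc 0 mod length vs = 1" "Suc 1 mod length vs = 2"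
      using vs(1) by auto
    thus ?thesis using vs(3)[of 0] vs(3)[of 1] by simp
  qed
  hence "vs ! 0 = vs ! 2" by (auto simp: doubleton_eq_iff)
  moreover have "0 < length vs" "2 < length vs" using vs(1) by auto
  ultimately show False using nth_eq_iff_index_eq[OF vs(2), of 0 2] by simp
qed

text \<open>The \<open>LEAST\<close> in \<open>arboricity\<close> is attained, because giving each
  edge a forest of its own is an admissible cover.\<close>

lemma arboricity_forests:
  assumes "finite E"
  obtains F :: "nat \<Rightarrow> nat set set" where
    "\<And>i. i < arboricity E \<Longrightarrow> F i \<subseteq> E" "\<And>i. i < arboricity E \<Longrightarrow> acyclic_edges (F i)"
    "E \<subseteq> (\<Union>i<arboricity E. F i)"
proof -
  obtain es where es: "set es = E" using finite_list[OF assms] by blast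
  let ?P = "\<lambda>k. \<exists>F :: nat \<Rightarrow> nat set set.
     (\<forall>i<k. F i \<subseteq> E \<and> acyclic_edges (F i)) \<and> E \<subseteq> (\<Union>i<k. F i)"
  have "?P (length es)"
    by (rule exI[of _ "\<lambda>i. {es ! i}"])
      (use es in \<open>auto simp: acyclic_edges_singleton in_set_conv_nth\<close>)
  hence "?P (arboricity E)" unfolding arboricity_def by (rule LeastI)
  thus ?thesis using that by blast
qed

lemma arboricity_pos:
  assumes "finite E" "E \<noteq> {}"
  shows "0 < arboricity E"
proof (rule ccontr)
  assume "\<not> ?thesis"
  hence "arboricity E = 0" by simp
  moreover obtain F :: "nat \<Rightarrow> nat set set" where "E \<subseteq> (\<Union>i<arboricity E. F i)"
    using arboricity_forests[OF assms(1)] by metis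
  ultimately show False using assms(2) by simp
qed

lemma card_pairs_le_arboricity:
  assumes "finite E" "\<And>e. e \<in> E \<Longrightarrow> card e = 2" "finite S"
  shows "card {(v, w) \<in> S \<times> S. {v, w} \<in> E} \<le> 2 * arboricity E * card S"
proof -
  obtain F where F: "\<And>i. i < arboricity E \<Longrightarrow> F i \<subseteq> E"
    "\<And>i. i < arboricity E \<Longrightarrow> acyclic_edges (F i)" "E \<subseteq> (\<Union>i<arboricity E. F i)"
    using arboricity_forests[OF assms(1)] by metis
  let ?P = "\<lambda>i. {(v, w) \<in> S \<times> S. {v, w} \<in> F i}"
  have "card {(v, w) \<in> S \<times> S. {v, w} \<in> E} \<le> card (\<Union>i<arboricity E. ?P i)"
    using F(3) assms(3) by (intro card_mono) (auto intro: finite_subset[of _ "S \<times> S"])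
  also have "\<dots> \<le> (\<Sum>i<arboricity E. card (?P i))" by (rule card_UN_le) simp
  also have "\<dots> \<le> (\<Sum>i<arboricity E. 2 * card S)"
    using F(1,2) assms by (intro sum_mono card_acyclic_pairs_le) blast+
  finally show ?thesis by simp
qed

section \<open>Sampling by truncated random walks\<close>

text \<open>Control states of the restarting loop, so that one corecursive function describes the
  whole unbounded interaction. The counter \<open>j\<close> is the number of edges to traverse after
  the next one; the last argument of \<open>Choose\<close> is the range from which the neighbour
  index is drawn.\<close>

datatype (discs_sels) walk_state =
    Start
  | Pick nat
  | Test nat nat
  | Choose nat nat nat
  | Probe nat nat nat
  | Continue nat nat
  | Done "nat set"

fun arrive :: "nat \<Rightarrow> nat \<Rightarrow> nat \<Rightarrow> walk_state" where
  "arrive 0 v w = Done {v, w}"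
| "arrive (Suc j) v w = Continue j w"

text \<open>Drawing the index of the first neighbour below \<open>t\<close> instead of below \<open>d(v)\<close> makes all edges
  leaving light vertices equally likely. Drawn indices start from 0, hence the shift in \<open>Probe\<close>.\<close>

primcorec sampler :: "nat \<Rightarrow> nat \<Rightarrow> walk_state \<Rightarrow> nat set query_alg" where
  "sampler l t s = (case s of
      Start \<Rightarrow> Random (Suc l) (\<lambda>j. sampler l t (Pick j))
    | Pick j \<Rightarrow> Vertex (\<lambda>v. sampler l t (Test j v))
    | Test j v \<Rightarrow> Deg v (\<lambda>d. sampler l t (if d \<le> t then Choose j v t else Start))
    | Choose j v k \<Rightarrow> Random k (\<lambda>i. sampler l t (Probe j v i))
    | Probe j v i \<Rightarrow> Nbr v (Suc i) (\<lambda>r. sampler l t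
        (case r of None \<Rightarrow> Start | Some w \<Rightarrow> arrive j v w))
    | Continue j w \<Rightarrow> Deg w (\<lambda>d. sampler l t (if d \<le> t then Start else Choose j w d))
    | Done e \<Rightarrow> Return e)"

text \<open>Boundedness of \<open>\<phi>\<close> gives integrability even for runs that may fail to
  terminate. If \<open>S\<close> is empty or infinite, both sides are 0.\<close>

lemma integral_bind_spmf_of_set:
  fixes \<phi> :: "'b \<Rightarrow> real"
  assumes "\<And>x. \<bar>\<phi> x\<bar> \<le> B"
  shows "(\<integral>x. \<phi> x \<partial>measure_spmf (bind_spmf (spmf_of_set S) f)) =
    (\<Sum>y\<in>S. \<integral>x. \<phi> x \<partial>measure_spmf (f y)) / card S"
proof -
  have "(\<integral>x. \<phi> x \<partial>measure_spmf (bind_spmf (spmf_of_set S) f)) =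
      (\<integral>y. (\<integral>x. \<phi> x \<partial>measure_spmf (f y)) \<partial>measure_spmf (spmf_of_set S))"
    unfolding measure_spmf_bind o_def
    by (rule integral_bind[where B = B and B' = 1 and K = "count_space UNIV"])
      (auto simp: assms measure_spmf.finite_measure_axioms measure_spmf.subprob_emeasure_le_1
        space_measure_spmf[symmetric] simp del: space_measure_spmf)
  thus ?thesis by (simp add: integral_spmf_of_set)
qed

lemma integrable_measure_spmf_bounded:
  fixes \<phi> :: "'b \<Rightarrow> real"
  assumes "\<And>x. \<bar>\<phi> x\<bar> \<le> B"
  shows "integrable (measure_spmf p) \<phi>"
  by (rule measure_spmf.integrable_const_bound[where B = B]) (auto simp: assms)

text \<open>Here \<open>\<kappa>\<close> is the price of one query. The value 0, with plus or minus
  the indicator of a result as \<open>\<phi>\<close>, will yield the output law; the value 1, with a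
  truncated query counter, will yield the cost.\<close>

lemma integral_map_apsnd_Suc_le:
  fixes \<phi> :: "'r \<times> nat \<Rightarrow> real"
  assumes bound: "\<And>x. \<bar>\<phi> x\<bar> \<le> B" and step: "\<And>e q. \<phi> (e, Suc q) \<le> \<phi> (e, q) + \<kappa>" and "0 \<le> \<kappa>"
  shows "(\<integral>x. \<phi> x \<partial>measure_spmf (map_spmf (apsnd Suc) p)) \<le> \<kappa> + (\<integral>x. \<phi> x \<partial>measure_spmf p)"
proof -
  have shifted: "\<bar>\<phi> x\<bar> \<le> B + \<kappa>" "\<bar>\<phi> x + \<kappa>\<bar> \<le> B + \<kappa>" for x
    using bound[of x] \<open>0 \<le> \<kappa>\<close> by linarith+
  have "(\<integral>x. \<phi> x \<partial>measure_spmf (map_spmf (apsnd Suc) p)) =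
      (\<integral>x. \<phi> (apsnd Suc x) \<partial>measure_spmf p)"
    by (simp add: measure_map_spmf_conv_distr integral_distr)
  also have "\<dots> \<le> (\<integral>x. \<phi> x + \<kappa> \<partial>measure_spmf p)"
    by (intro integral_mono integrable_measure_spmf_bounded[where B = "B + \<kappa>"])
      (auto simp: step shifted)
  also have "\<dots> = (\<integral>x. \<phi> x \<partial>measure_spmf p) + \<kappa> * weight_spmf p"
    by (subst Bochner_Integration.integral_add)
      (auto simp: integrable_measure_spmf_bounded[where B = B, OF bound] weight_spmf_def)
  also have "\<kappa> * weight_spmf p \<le> \<kappa>"
    using mult_left_mono[OF weight_spmf_le_1 \<open>0 \<le> \<kappa>\<close>] by simp
  finally show ?thesis by simp
qed

lemma run_sampler:
  "run n E adj (sampler l t Start) =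
     bind_spmf (spmf_of_set {..<Suc l}) (\<lambda>j. run n E adj (sampler l t (Pick j)))"
  "run n E adj (sampler l t (Pick j)) =
     bind_spmf (spmf_of_set {1..n}) (\<lambda>v. run n E adj (sampler l t (Test j v)))"
  "run n E adj (sampler l t (Test j v)) = map_spmf (apsnd Suc)
     (run n E adj (sampler l t (if degree E v \<le> t then Choose j v t else Start)))"
  "run n E adj (sampler l t (Choose j v k)) =
     bind_spmf (spmf_of_set {..<k}) (\<lambda>i. run n E adj (sampler l t (Probe j v i)))"
  "run n E adj (sampler l t (Probe j v i)) = map_spmf (apsnd Suc) (run n E adj (sampler l t
     (if i < length (adj v) then arrive j v (adj v ! i) else Start)))"
  "run n E adj (sampler l t (Continue j v)) = map_spmf (apsnd Suc)
     (run n E adj (sampler l t (if degree E v \<le> t then Start else Choose j v (degree E v))))"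
  "run n E adj (sampler l t (Done e)) = return_spmf (e, 0)"
  by (subst sampler.code, subst run.simps, simp add: nth_neighbour_def)+

section \<open>Reversibility of the walk\<close>

locale walk =
  fixes n :: nat and E :: "nat set set" and adj :: "nat \<Rightarrow> nat list" and l t :: nat
  assumes graph: "simple_graph {1..n} E"
    and ordering: "neighbour_ordering E adj"
    and n_pos: "0 < n" and t_pos: "0 < t"
begin

abbreviation light :: "nat \<Rightarrow> bool" where
  "light v \<equiv> degree E v \<le> t"

lemma neighbours_subset: "neighbours E v \<subseteq> {1..n}"
  using graph by (auto simp: neighbours_def simple_graph_def)

lemma finite_neighbours [simp]: "finite (neighbours E v)"
  using neighbours_subset finite_subset by blast

lemma neighbours_sym: "w \<in> neighbours E v \<longleftrightarrow> v \<in> neighbours E w"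
  by (simp add: neighbours_def insert_commute)

lemma length_adj: "length (adj v) = degree E v"
  using ordering by (metis degree_def distinct_card neighbour_ordering_def)

lemma sum_adj: "(\<Sum>i<degree E v. f (adj v ! i)) = (\<Sum>w\<in>neighbours E v. f w)"
  using ordering bij_betw_nth[of "adj v" "{..<degree E v}" "neighbours E v"]
  by (intro sum.reindex_bij_betw) (simp add: neighbour_ordering_def length_adj)

lemma neighbours_swap:
  "(\<Sum>v\<in>{1..n}. \<Sum>w\<in>neighbours E v. f v w) = (\<Sum>w\<in>{1..n}. \<Sum>v\<in>neighbours E w. f v w)"
proof -
  have "(\<Sum>v\<in>{1..n}. \<Sum>w\<in>neighbours E v. f v w) =
      (\<Sum>v\<in>{1..n}. \<Sum>w\<in>{1..n}. if w \<in> neighbours E v then f v w else 0)"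
    using neighbours_subset by (intro sum.cong refl sum.mono_neutral_cong_left) auto
  also have "\<dots> = (\<Sum>w\<in>{1..n}. \<Sum>v\<in>{1..n}. if v \<in> neighbours E w then f v w else 0)"
    by (subst sum.swap) (simp add: neighbours_sym)
  also have "\<dots> = (\<Sum>w\<in>{1..n}. \<Sum>v\<in>neighbours E w. f v w)"
    using neighbours_subset by (intro sum.cong refl sum.mono_neutral_cong_right) auto
  finally show ?thesis .
qed

text \<open>Expected \<open>h\<close> of the edge returned by an attempt that has just traversed
  \<open>(v, w)\<close> with \<open>j\<close> steps left; a failed attempt counts 0.\<close>

primrec gain :: "(nat set \<Rightarrow> real) \<Rightarrow> nat \<Rightarrow> nat \<Rightarrow> nat \<Rightarrow> real" where
  "gain h 0 v w = h {v, w}"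
| "gain h (Suc j) v w =
     (if light w then 0 else (\<Sum>u\<in>neighbours E w. gain h j w u) / degree E w)"

primrec reach :: "nat \<Rightarrow> nat \<Rightarrow> real" where
  "reach 0 v = (if light v then 1 else 0)"
| "reach (Suc j) v = (if light v then 0 else (\<Sum>u\<in>neighbours E v. reach j u) / degree E v)"

text \<open>Reversibility: the walk of \<open>j\<close> steps that started at a light vertex leaves \<open>v\<close> along each edge
  with weight \<open>reach j v\<close>, the probability that the walk from \<open>v\<close> first meets a light vertex at
  time \<open>j\<close>.\<close>

lemma sum_gain_reach:
  "(\<Sum>v\<in>{1..n}. \<Sum>w\<in>neighbours E v. reach i v * gain h j v w) =
   (\<Sum>v\<in>{1..n}. \<Sum>w\<in>neighbours E v. reach (i + j) v * h {v, w})"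
proof (induction j arbitrary: i)
  case (Suc j)
  have "(\<Sum>v\<in>{1..n}. \<Sum>w\<in>neighbours E v. reach i v * gain h (Suc j) v w) =
      (\<Sum>w\<in>{1..n}. \<Sum>v\<in>neighbours E w. reach i v * gain h (Suc j) v w)"
    by (rule neighbours_swap)
  \<comment> \<open>The factor \<open>1 / degree E w\<close> moves from \<open>gain\<close> to the
    sum of \<open>reach i v\<close> over the neighbours of \<open>w\<close>, which becomes
    \<open>reach (Suc i) w\<close>. At light \<open>w\<close> both sides vanish.\<close>
  also have "\<dots> = (\<Sum>w\<in>{1..n}. \<Sum>u\<in>neighbours E w. reach (Suc i) w * gain h j w u)"
    by (rule sum.cong[OF refl]) (simp add: sum_distrib_left[symmetric] sum_distrib_right[symmetric])
  finally show ?case using Suc.IH[of "Suc i"] by simp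
qed simp

definition hit :: "nat \<Rightarrow> real" where
  "hit v = (\<Sum>j\<le>l. reach j v)"

lemma start_gain:
  "(\<Sum>j\<le>l. \<Sum>v\<in>{1..n}. if light v then \<Sum>w\<in>neighbours E v. gain h j v w else 0) =
   (\<Sum>v\<in>{1..n}. \<Sum>w\<in>neighbours E v. hit v * h {v, w})"
proof -
  have "(\<Sum>v\<in>{1..n}. if light v then \<Sum>w\<in>neighbours E v. gain h j v w else 0) =
      (\<Sum>v\<in>{1..n}. \<Sum>w\<in>neighbours E v. reach j v * h {v, w})" for j
  proof -
    have "(\<Sum>v\<in>{1..n}. if light v then \<Sum>w\<in>neighbours E v. gain h j v w else 0) =
        (\<Sum>v\<in>{1..n}. \<Sum>w\<in>neighbours E v. reach 0 v * gain h j v w)"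
      by (rule sum.cong) auto
    thus ?thesis using sum_gain_reach[of 0 h j] by simp
  qed
  thus ?thesis
    by (simp add: hit_def sum_distrib_right) (subst sum.swap, simp add: sum.swap[of _ _ "{..l}"])
qed

section \<open>Renewal inequality for repeated attempts\<close>

context
  fixes \<phi> :: "nat set \<times> nat \<Rightarrow> real" and B \<kappa> :: real
  assumes bound: "\<And>x. \<bar>\<phi> x\<bar> \<le> B" and step: "\<And>e q. \<phi> (e, Suc q) \<le> \<phi> (e, q) + \<kappa>" and "0 \<le> \<kappa>"
begin

private definition val :: "walk_state \<Rightarrow> real" where
  "val s = (\<integral>x. \<phi> x \<partial>measure_spmf (run n E adj (sampler l t s)))"

text \<open>Advantage of finishing with \<open>e\<close> over starting again. Measured this way a
  failed attempt, which restarts, contributes 0, as in \<open>gain\<close>.\<close>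

private definition excess :: "nat set \<Rightarrow> real" where
  "excess e = \<phi> (e, 0) - val Start"

private lemma val_bind:
  "run n E adj (sampler l t s) = bind_spmf (spmf_of_set S) (\<lambda>x. run n E adj (sampler l t (f x))) \<Longrightarrow>
    val s = (\<Sum>x\<in>S. val (f x)) / card S"
  unfolding val_def by (simp add: integral_bind_spmf_of_set[OF bound])

private lemma val_query:
  "run n E adj (sampler l t s) = map_spmf (apsnd Suc) (run n E adj (sampler l t s')) \<Longrightarrow>
    val s \<le> \<kappa> + val s'"
  unfolding val_def by (simp add: integral_map_apsnd_Suc_le[OF bound step \<open>0 \<le> \<kappa>\<close>])

private lemmas val_Start = val_bind[OF run_sampler(1)]
private lemmas val_Pick = val_bind[OF run_sampler(2)]
private lemmas val_Test = val_query[OF run_sampler(3)]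
private lemmas val_Choose = val_bind[OF run_sampler(4)]
private lemmas val_Probe = val_query[OF run_sampler(5)]
private lemmas val_Continue = val_query[OF run_sampler(6)]

private lemma val_Done: "val (Done e) = \<phi> (e, 0)"
  by (simp add: val_def run_sampler(7) measure_spmf_return_spmf integral_return)

text \<open>Each remaining step costs at most two queries, one for the degree and one for the
  neighbour.\<close>

private lemma val_arrive: "val (arrive j v w) \<le> 2 * real j * \<kappa> + val Start + gain excess j v w"
proof (induction j arbitrary: v w)
  case 0
  show ?case by (simp add: val_Done excess_def)
next
  case (Suc j)
  show ?case
  proof (cases "light w")
    case True
    have "0 \<le> (1 + 2 * real j) * \<kappa>" using \<open>0 \<le> \<kappa>\<close> by simp
    thus ?thesis using True val_Continue[of j w] by (simp add: algebra_simps)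
  next
    case False
    let ?d = "degree E w"
    have d: "0 < real ?d" using False by simp
    have "val (Choose j w ?d) * ?d = (\<Sum>i<?d. val (Probe j w i))"
      using d by (simp add: val_Choose)
    also have "\<dots> \<le> (\<Sum>i<?d. (2 * real j + 1) * \<kappa> + val Start + gain excess j w (adj w ! i))"
    proof (rule sum_mono)
      fix i assume "i \<in> {..<?d}"
      thus "val (Probe j w i) \<le> (2 * real j + 1) * \<kappa> + val Start + gain excess j w (adj w ! i)"
        using val_Probe[of j w i] Suc.IH[of w "adj w ! i"] by (simp add: length_adj algebra_simps)
    qed
    also have "\<dots> = ?d * ((2 * real j + 1) * \<kappa> + val Start) + (\<Sum>u\<in>neighbours E w. gain excess j w u)"
      by (simp add: sum.distrib sum_adj algebra_simps)
    also have "\<dots> = ((2 * real j + 1) * \<kappa> + val Start + gain excess (Suc j) v w) * ?d"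
      using False d by (simp add: algebra_simps)
    finally have "val (Choose j w ?d) \<le> (2 * real j + 1) * \<kappa> + val Start + gain excess (Suc j) v w"
      using d by (simp only: mult_le_cancel_right_pos)
    thus ?thesis using val_Continue[of j w] False by (simp add: algebra_simps)
  qed
qed

text \<open>The degree test and the first probe add two queries. Indices from
  \<open>degree E v\<close> up to \<open>t\<close> lead to a restart, so every edge leaving a light
  vertex has weight \<open>1 / t\<close>.\<close>

private lemma val_Test_le:
  "val (Test j v) \<le> (2 * real j + 2) * \<kappa> + val Start +
     (if light v then \<Sum>w\<in>neighbours E v. gain excess j v w else 0) / t"
proof (cases "light v")
  case False
  have "0 \<le> (1 + 2 * real j) * \<kappa>" using \<open>0 \<le> \<kappa>\<close> by simp
  thus ?thesis using False val_Test[of j v] by (simp add: algebra_simps)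
next
  case True
  let ?d = "degree E v"
  have "val (Choose j v t) * t = (\<Sum>i<t. val (Probe j v i))"
    using t_pos by (simp add: val_Choose)
  also have "\<dots> \<le> (\<Sum>i<t. (2 * real j + 1) * \<kappa> + val Start +
      (if i < ?d then gain excess j v (adj v ! i) else 0))"
  proof (rule sum_mono)
    fix i assume "i \<in> {..<t}"
    have "0 \<le> 2 * real j * \<kappa>" using \<open>0 \<le> \<kappa>\<close> by simp
    thus "val (Probe j v i) \<le> (2 * real j + 1) * \<kappa> + val Start +
        (if i < ?d then gain excess j v (adj v ! i) else 0)"
      using val_Probe[of j v i] val_arrive[of j v "adj v ! i"]
      by (auto simp: length_adj algebra_simps)
  qed
  also have "\<dots> = t * ((2 * real j + 1) * \<kappa> + val Start) +
      (\<Sum>i<t. if i < ?d then gain excess j v (adj v ! i) else 0)"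
    by (simp add: sum.distrib algebra_simps)
  also have "(\<Sum>i<t. if i < ?d then gain excess j v (adj v ! i) else 0) =
      (\<Sum>i<?d. gain excess j v (adj v ! i))"
    using True by (intro sum.mono_neutral_cong_right) auto
  also have "\<dots> = (\<Sum>w\<in>neighbours E v. gain excess j v w)" by (rule sum_adj)
  also have "t * ((2 * real j + 1) * \<kappa> + val Start) + \<dots> =
      ((2 * real j + 1) * \<kappa> + val Start + (\<Sum>w\<in>neighbours E v. gain excess j v w) / t) * t"
    using t_pos by (simp add: algebra_simps)
  finally have "val (Choose j v t) \<le>
      (2 * real j + 1) * \<kappa> + val Start + (\<Sum>w\<in>neighbours E v. gain excess j v w) / t"
    using t_pos by (simp only: mult_le_cancel_right_pos of_nat_0_less_iff)
  thus ?thesis using val_Test[of j v] True by (simp add: algebra_simps)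
qed

text \<open>Averaging \<open>val_Test_le\<close> over \<open>j\<close> and \<open>v\<close> and
  applying \<open>start_gain\<close> to \<open>excess\<close> puts \<open>val Start\<close> on both
  sides. It is finite and cancels, except for the multiple contributed by \<open>excess\<close>,
  which is the sum of \<open>hit\<close>. The factor \<open>(real l + 1) * real n * real t\<close>
  is the inverse probability of each choice of length, vertex and index.\<close>

lemma run_Start_integral_le:
  "(\<integral>x. \<phi> x \<partial>measure_spmf (run n E adj (sampler l t Start))) *
      (\<Sum>v\<in>{1..n}. \<Sum>w\<in>neighbours E v. hit v)
    \<le> (2 * real l + 2) * \<kappa> * ((real l + 1) * real n * real t) +
      (\<Sum>v\<in>{1..n}. \<Sum>w\<in>neighbours E v. hit v * \<phi> ({v, w}, 0))"
proof -
  let ?G = "\<lambda>j v. if light v then \<Sum>w\<in>neighbours E v. gain excess j v w else 0"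
  let ?K = "(2 * real l + 2) * \<kappa> + val Start"
  have "1 + real l \<noteq> 0" by linarith
  hence "val Start * (real l + 1) = (\<Sum>j\<le>l. val (Pick j))"
    by (subst val_Start) (simp add: lessThan_Suc_atMost add.commute)
  hence "val Start * (real l + 1) * n = (\<Sum>j\<le>l. \<Sum>v\<in>{1..n}. val (Test j v))"
    using n_pos by (simp add: val_Pick sum_divide_distrib[symmetric])
  also have "\<dots> \<le> (\<Sum>j\<le>l. \<Sum>v\<in>{1..n}. ?K + ?G j v / t)"
  proof (intro sum_mono)
    fix j v assume "j \<in> {..l}"
    hence "(2 * real j + 2) * \<kappa> \<le> (2 * real l + 2) * \<kappa>"
      using \<open>0 \<le> \<kappa>\<close> by (intro mult_right_mono) auto
    thus "val (Test j v) \<le> ?K + ?G j v / t" using val_Test_le[of j v] by linarith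
  qed
  also have "\<dots> = (real l + 1) * n * ?K + (\<Sum>j\<le>l. \<Sum>v\<in>{1..n}. ?G j v) / t"
    by (simp add: sum.distrib sum_divide_distrib[symmetric] algebra_simps)
  also have "(\<Sum>j\<le>l. \<Sum>v\<in>{1..n}. ?G j v) =
      (\<Sum>v\<in>{1..n}. \<Sum>w\<in>neighbours E v. hit v * excess {v, w})" by (rule start_gain)
  also have "\<dots> = (\<Sum>v\<in>{1..n}. \<Sum>w\<in>neighbours E v. hit v * \<phi> ({v, w}, 0)) -
      val Start * (\<Sum>v\<in>{1..n}. \<Sum>w\<in>neighbours E v. hit v)"
    by (simp add: excess_def right_diff_distrib sum_subtractf sum_distrib_left mult_ac)
  finally have "0 \<le> (real l + 1) * n * ((2 * real l + 2) * \<kappa>) +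
      ((\<Sum>v\<in>{1..n}. \<Sum>w\<in>neighbours E v. hit v * \<phi> ({v, w}, 0)) -
       val Start * (\<Sum>v\<in>{1..n}. \<Sum>w\<in>neighbours E v. hit v)) / t"
    by (simp add: algebra_simps)
  hence "0 \<le> ((real l + 1) * n * ((2 * real l + 2) * \<kappa>) +
      ((\<Sum>v\<in>{1..n}. \<Sum>w\<in>neighbours E v. hit v * \<phi> ({v, w}, 0)) -
       val Start * (\<Sum>v\<in>{1..n}. \<Sum>w\<in>neighbours E v. hit v)) / t) * t"
    by simp
  also have "\<dots> = (real l + 1) * n * ((2 * real l + 2) * \<kappa>) * t +
      ((\<Sum>v\<in>{1..n}. \<Sum>w\<in>neighbours E v. hit v * \<phi> ({v, w}, 0)) -
       val Start * (\<Sum>v\<in>{1..n}. \<Sum>w\<in>neighbours E v. hit v))"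
    using t_pos by (subst distrib_right) simp
  also have "(real l + 1) * n * ((2 * real l + 2) * \<kappa>) * t =
      (2 * real l + 2) * \<kappa> * ((real l + 1) * real n * real t)"
    by (simp only: mult_ac)
  finally show ?thesis unfolding val_def by linarith
qed

end

section \<open>Hitting probabilities and peeling\<close>

lemma reach_nonneg: "0 \<le> reach j v"
  by (induction j arbitrary: v) (auto intro!: sum_nonneg divide_nonneg_nonneg)

lemma sum_reach_Suc:
  "(\<Sum>j\<le>Suc k. reach j v) =
     (if light v then 1 else (\<Sum>u\<in>neighbours E v. \<Sum>j\<le>k. reach j u) / degree E v)"
  by (simp add: sum.atMost_Suc_shift del: sum.atMost_Suc)
    (simp add: sum_divide_distrib[symmetric] sum.swap[of _ "neighbours E v"])

lemma sum_reach_le_1: "(\<Sum>j\<le>k. reach j v) \<le> 1"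
proof (induction k arbitrary: v)
  case (Suc k)
  have "(\<Sum>u\<in>neighbours E v. \<Sum>j\<le>k. reach j u) \<le> (\<Sum>u\<in>neighbours E v. 1)"
    by (intro sum_mono Suc.IH)
  thus ?case unfolding sum_reach_Suc by (auto simp: degree_def divide_le_eq)
qed simp

primrec core :: "real \<Rightarrow> nat \<Rightarrow> nat set" where
  "core \<delta> 0 = {v \<in> {1..n}. \<not> light v}"
| "core \<delta> (Suc k) = {v \<in> core \<delta> k. \<delta> * degree E v < card (neighbours E v \<inter> core \<delta> k)}"

lemma core_subset: "core \<delta> k \<subseteq> {v \<in> {1..n}. \<not> light v}"
  by (induction k) auto

lemma finite_core [simp]: "finite (core \<delta> k)"
  using core_subset[of \<delta> k] by (rule finite_subset) simp

text \<open>A heavy vertex peeled in round \<open>k + 1\<close> steps outside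
  \<open>core \<delta> k\<close> with probability at least \<open>1 - \<delta>\<close> and then
  succeeds within \<open>k\<close> steps with probability at least \<open>1 - k * \<delta>\<close>;
  the product is at least \<open>1 - (k + 1) * \<delta>\<close>.\<close>

lemma sum_reach_ge:
  assumes "0 \<le> \<delta>" "v \<in> {1..n}" "v \<notin> core \<delta> k"
  shows "1 - k * \<delta> \<le> (\<Sum>j\<le>k. reach j v)"
  using assms(2,3)
proof (induction k arbitrary: v)
  case (Suc k)
  \<comment> \<open>In the second case the claimed bound is negative. Setting it aside ensures that
    \<open>1 - k * \<delta>\<close> is nonnegative, which the multiplication in the last case
    needs.\<close>
  consider "light v" | "1 < Suc k * \<delta>" | "v \<notin> core \<delta> k" |
    "\<not> light v" "Suc k * \<delta> \<le> 1" "v \<in> core \<delta> k" by linarith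
  thus ?case
  proof cases
    case 1
    thus ?thesis unfolding sum_reach_Suc using \<open>0 \<le> \<delta>\<close> by simp
  next
    case 2
    thus ?thesis using sum_nonneg[of "{..Suc k}" "\<lambda>j. reach j v"] reach_nonneg by force
  next
    case 3
    have "1 - Suc k * \<delta> \<le> 1 - k * \<delta>" using \<open>0 \<le> \<delta>\<close> by (simp add: algebra_simps)
    also have "\<dots> \<le> (\<Sum>j\<le>k. reach j v)" using Suc 3 by blast
    also have "\<dots> \<le> (\<Sum>j\<le>Suc k. reach j v)" using reach_nonneg[of "Suc k" v] by (simp del: reach.simps)
    finally show ?thesis .
  next
    case 4
    let ?N = "neighbours E v" and ?C = "core \<delta> k"
    have c: "real (card (?N \<inter> ?C)) \<le> \<delta> * degree E v" using Suc.prems 4 by auto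
    have k: "0 \<le> 1 - k * \<delta>" using 4 \<open>0 \<le> \<delta>\<close> by (simp add: algebra_simps)
    have "(1 - Suc k * \<delta>) * degree E v \<le> (1 - k * \<delta>) * ((1 - \<delta>) * degree E v)"
      using \<open>0 \<le> \<delta>\<close> by (simp add: algebra_simps)
    also have "\<dots> \<le> (1 - k * \<delta>) * card (?N - ?C)"
    proof (rule mult_left_mono[OF _ k])
      have "card ?N = card (?N - ?C) + card (?N \<inter> ?C)"
        by (simp add: card_Diff_subset_Int card_mono)
      thus "(1 - \<delta>) * degree E v \<le> card (?N - ?C)"
        using c by (simp add: degree_def algebra_simps)
    qed
    also have "\<dots> = (\<Sum>u\<in>?N - ?C. 1 - k * \<delta>)" by simp
    also have "\<dots> \<le> (\<Sum>u\<in>?N - ?C. \<Sum>j\<le>k. reach j u)"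
      using neighbours_subset[of v] by (intro sum_mono Suc.IH) auto
    also have "\<dots> \<le> (\<Sum>u\<in>?N. \<Sum>j\<le>k. reach j u)"
      by (intro sum_mono2) (auto intro: sum_nonneg reach_nonneg)
    finally show ?thesis
      unfolding sum_reach_Suc using 4 by (simp add: pos_le_divide_eq)
  qed
qed simp

lemma edge_card: "e \<in> E \<Longrightarrow> card e = 2"
  using graph by (simp add: simple_graph_def)

lemma finite_E: "finite E"
  by (rule finite_subset[of _ "Pow {1..n}"]) (use graph in \<open>auto simp: simple_graph_def\<close>)

text \<open>Each vertex of the new core has at least \<open>\<delta> * t\<close>, hence four times
  the arboricity, neighbours in the old core. By \<open>card_pairs_le_arboricity\<close> the old
  core has, per vertex, at most twice the arboricity of adjacent ordered pairs.\<close>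

lemma core_halves:
  fixes \<delta> :: real
  assumes "4 * arboricity E \<le> \<delta> * t" "0 \<le> \<delta>" "0 < arboricity E"
  shows "2 * card (core \<delta> (Suc k)) \<le> card (core \<delta> k)"
proof -
  let ?C = "core \<delta> k" and ?D = "core \<delta> (Suc k)" and ?a = "arboricity E"
  have "4 * real ?a * card ?D \<le> (\<Sum>v\<in>?D. \<delta> * t)"
    using mult_right_mono[OF assms(1), of "real (card ?D)"] by (simp add: mult_ac)
  also have "\<dots> \<le> (\<Sum>v\<in>?D. real (card (neighbours E v \<inter> ?C)))"
  proof (rule sum_mono)
    fix v assume v: "v \<in> ?D"
    have "\<delta> * t \<le> \<delta> * degree E v"
      using v core_subset[of \<delta> "Suc k"] \<open>0 \<le> \<delta>\<close> by (intro mult_left_mono) auto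
    thus "\<delta> * t \<le> card (neighbours E v \<inter> ?C)" using v by simp
  qed
  also have "\<dots> \<le> (\<Sum>v\<in>?C. real (card (neighbours E v \<inter> ?C)))"
    by (intro sum_mono2) auto
  also have "\<dots> = card (SIGMA v:?C. neighbours E v \<inter> ?C)" by simp
  also have "(SIGMA v:?C. neighbours E v \<inter> ?C) = {(v, w) \<in> ?C \<times> ?C. {v, w} \<in> E}"
    by (auto simp: neighbours_def)
  also have "real (card \<dots>) \<le> real (2 * ?a * card ?C)"
    by (intro of_nat_mono card_pairs_le_arboricity finite_E edge_card finite_core)
  finally have "real ?a * (2 * real (card ?D)) \<le> real ?a * card ?C" by simp
  hence "2 * real (card ?D) \<le> card ?C" using assms(3) by simp
  thus ?thesis by linarith
qed

lemma core_empty: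
  fixes \<delta> :: real
  assumes "4 * arboricity E \<le> \<delta> * t" "0 \<le> \<delta>" "0 < arboricity E" "n < 2 ^ k"
  shows "core \<delta> k = {}"
proof -
  have "2 ^ k * card (core \<delta> k) \<le> n"
  proof (induction k)
    case 0
    have "card (core \<delta> 0) \<le> card {1..n}" by (intro card_mono) auto
    thus ?case by simp
  next
    case (Suc k)
    have "2 ^ Suc k * card (core \<delta> (Suc k)) \<le> 2 ^ k * card (core \<delta> k)"
      using mult_le_mono2[OF core_halves[OF assms(1-3)], of "2 ^ k" k] by simp
    thus ?case using Suc.IH by linarith
  qed
  hence "card (core \<delta> k) = 0" using assms(4) by (cases "card (core \<delta> k)") auto
  thus ?thesis by simp
qed

lemma hit_bounds:
  fixes \<delta> :: real
  assumes "4 * arboricity E \<le> \<delta> * t" "0 \<le> \<delta>" "0 < arboricity E" "n < 2 ^ l" "v \<in> {1..n}"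
  shows "1 - l * \<delta> \<le> hit v" "hit v \<le> 1"
  unfolding hit_def using sum_reach_ge[of \<delta> v l] sum_reach_le_1 core_empty[OF assms(1-4)] assms
  by auto

text \<open>For an edge \<open>e\<close> this is \<open>(l + 1) * n * t\<close> times the
  probability that one attempt returns \<open>e\<close>; the two summands belong to its
  orientations.\<close>

definition weight :: "nat set \<Rightarrow> real" where
  "weight e = (\<Sum>v\<in>e. hit v)"

lemma sum_neighbours_edges:
  "(\<Sum>v\<in>{1..n}. \<Sum>w\<in>neighbours E v. f v {v, w}) = (\<Sum>e\<in>E. \<Sum>v\<in>e. f v e)"
proof -
  have "(\<Sum>w\<in>neighbours E v. f v {v, w}) = (\<Sum>e\<in>{e \<in> E. v \<in> e}. f v e)" for v
  proof (rule sum.reindex_bij_betw)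
    have "e \<in> (\<lambda>w. {v, w}) ` neighbours E v" if "e \<in> E" "v \<in> e" for e
    proof -
      obtain x y where "e = {x, y}" using edge_card[OF \<open>e \<in> E\<close>] by (auto simp: card_2_iff)
      thus ?thesis using that by (auto simp: neighbours_def insert_commute)
    qed
    thus "bij_betw (\<lambda>w. {v, w}) (neighbours E v) {e \<in> E. v \<in> e}"
      by (auto simp: bij_betw_def inj_on_def doubleton_eq_iff neighbours_def)
  qed
  hence "(\<Sum>v\<in>{1..n}. \<Sum>w\<in>neighbours E v. f v {v, w}) =
      (\<Sum>e\<in>E. \<Sum>v\<in>{v \<in> {1..n}. v \<in> e}. f v e)"
    by (simp add: sum.swap_restrict finite_E)
  also have "\<dots> = (\<Sum>e\<in>E. \<Sum>v\<in>e. f v e)"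
  proof (rule sum.cong[OF refl])
    fix e assume "e \<in> E"
    hence "{v \<in> {1..n}. v \<in> e} = e" using graph unfolding simple_graph_def by blast
    thus "(\<Sum>v\<in>{v \<in> {1..n}. v \<in> e}. f v e) = (\<Sum>v\<in>e. f v e)" by simp
  qed
  finally show ?thesis .
qed

section \<open>Output law and query cost\<close>

lemma run_Start_integral_weight_le:
  fixes \<phi> :: "nat set \<times> nat \<Rightarrow> real"
  assumes "\<And>x. \<bar>\<phi> x\<bar> \<le> B" "\<And>e q. \<phi> (e, Suc q) \<le> \<phi> (e, q) + \<kappa>" "0 \<le> \<kappa>"
  shows "(\<integral>x. \<phi> x \<partial>measure_spmf (run n E adj (sampler l t Start))) * (\<Sum>e\<in>E. weight e)
    \<le> (2 * real l + 2) * \<kappa> * ((real l + 1) * real n * real t) + (\<Sum>e\<in>E. weight e * \<phi> (e, 0))"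
  using run_Start_integral_le[OF assms] sum_neighbours_edges[of "\<lambda>v e. hit v"]
    sum_neighbours_edges[of "\<lambda>v e. hit v * \<phi> (e, 0)"]
  by (simp add: weight_def sum_distrib_right)

text \<open>The indicator of a result ignores the query count, so \<open>\<kappa> = 0\<close> is
  allowed; the estimate for it and for its negative together give equality.\<close>

lemma spmf_output:
  "spmf (output_distribution n E adj (sampler l t Start)) e * (\<Sum>e\<in>E. weight e) =
     (if e \<in> E then weight e else 0)"
proof -
  let ?p = "run n E adj (sampler l t Start)"
  let ?I = "\<lambda>x :: nat set \<times> nat. indicator {x. fst x = e} x :: real"
  have "spmf (output_distribution n E adj (sampler l t Start)) e =
      measure (measure_spmf ?p) {x. fst x = e}"
    by (simp add: output_distribution_def spmf_conv_measure_spmf measure_map_spmf vimage_def)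
  also have "\<dots> = (\<integral>x. ?I x \<partial>measure_spmf ?p)" by simp
  finally have I: "(\<integral>x. ?I x \<partial>measure_spmf ?p) =
      spmf (output_distribution n E adj (sampler l t Start)) e" ..
  have "(\<Sum>e'\<in>E. weight e' * ?I (e', 0)) = (if e \<in> E then weight e else 0)"
    using finite_E by (simp add: indicator_def if_distrib sum.delta cong: if_cong)
  thus ?thesis
    using run_Start_integral_weight_le[of ?I 1 0] run_Start_integral_weight_le[of "\<lambda>x. - ?I x" 1 0]
    unfolding Bochner_Integration.integral_minus I
    by (simp add: sum_negf indicator_def)
qed

text \<open>The normalised weights of the edges already add up to 1, so almost sure termination
  follows from the point masses.\<close>

lemma output_lossless:
  assumes W: "0 < (\<Sum>e\<in>E. weight e)"
  obtains U where "output_distribution n E adj (sampler l t Start) = spmf_of_pmf U"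
    "set_pmf U \<subseteq> E" "\<And>e. e \<in> E \<Longrightarrow> pmf U e = weight e / (\<Sum>e\<in>E. weight e)"
proof -
  let ?p = "output_distribution n E adj (sampler l t Start)"
  have spmf: "spmf ?p e = (if e \<in> E then weight e / (\<Sum>e\<in>E. weight e) else 0)" for e
    using spmf_output[of e] W by (auto simp: eq_divide_eq)
  have "ennreal (weight_spmf ?p) = (\<integral>\<^sup>+ e. ennreal (spmf ?p e) \<partial>count_space UNIV)"
    by (rule weight_spmf_eq_nn_integral_spmf)
  also have "\<dots> = (\<Sum>e\<in>E. ennreal (spmf ?p e))"
    by (rule nn_integral_count_space') (auto simp: spmf finite_E)
  also have "\<dots> = ennreal (\<Sum>e\<in>E. spmf ?p e)" by (rule sum_ennreal) simp
  also have "(\<Sum>e\<in>E. spmf ?p e) = 1"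
    using W by (simp add: spmf sum_divide_distrib[symmetric])
  finally have "lossless_spmf ?p" by (simp add: lossless_spmf_def)
  then obtain U where U: "?p = spmf_of_pmf U" by (auto simp: lossless_spmf_conv_spmf_of_pmf)
  have pmf: "pmf U e = (if e \<in> E then weight e / (\<Sum>e\<in>E. weight e) else 0)" for e
    using spmf[of e] by (simp add: U)
  show ?thesis
    by (rule that[OF U]) (auto simp: pmf set_pmf_iff split: if_splits)
qed

text \<open>The recursive estimate for the cost is vacuous if the expectation is infinite, so it is applied
  to the truncated number of queries.\<close>

lemma expected_queries_le:
  assumes W: "0 < (\<Sum>e\<in>E. weight e)"
  shows "expected_queries n E adj (sampler l t Start)
    \<le> ennreal ((2 * real l + 2) * ((real l + 1) * real n * real t) / (\<Sum>e\<in>E. weight e))"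
    (is "_ \<le> ennreal ?b")
proof -
  let ?p = "measure_spmf (run n E adj (sampler l t Start))"
  let ?c = "\<lambda>N x. real (min (snd (x :: nat set \<times> nat)) N)"
  have trunc: "(\<integral>\<^sup>+ x. ennreal (?c N x) \<partial>?p) \<le> ennreal ?b" for N
  proof -
    \<comment> \<open>The truncated counter grows by at most 1 per query and is 0 at
      \<open>(e, 0)\<close>, so the last sum vanishes.\<close>
    have "(\<integral>x. ?c N x \<partial>?p) * (\<Sum>e\<in>E. weight e) \<le>
        (2 * real l + 2) * 1 * ((real l + 1) * real n * real t) + (\<Sum>e\<in>E. weight e * ?c N (e, 0))"
      by (rule run_Start_integral_weight_le[of "?c N" N 1]) auto
    hence "(\<integral>x. ?c N x \<partial>?p) \<le> ?b" using W by (simp add: pos_le_divide_eq)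
    moreover have "(\<integral>\<^sup>+ x. ennreal (?c N x) \<partial>?p) = ennreal (\<integral>x. ?c N x \<partial>?p)"
      by (intro nn_integral_eq_integral integrable_measure_spmf_bounded[of _ N]) auto
    ultimately show ?thesis by (simp add: ennreal_leI)
  qed
  have "of_nat q = (SUP N. ennreal (real (min q N)))" for q
    by (intro antisym SUP_least SUP_upper2[of q]) (auto simp: ennreal_of_nat_eq_real_of_nat)
  hence "expected_queries n E adj (sampler l t Start) = (\<integral>\<^sup>+ x. (SUP N. ennreal (?c N x)) \<partial>?p)"
    by (simp add: expected_queries_def)
  also have "\<dots> = (SUP N. \<integral>\<^sup>+ x. ennreal (?c N x) \<partial>?p)"
    by (rule nn_integral_monotone_convergence_SUP) (auto simp: incseq_def le_fun_def intro!: ennreal_leI)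
  also have "\<dots> \<le> ennreal ?b" by (intro SUP_least trunc)
  finally show ?thesis .
qed

lemma weight_bounds:
  fixes \<epsilon> :: real
  assumes "8 * real (arboricity E) * real l \<le> \<epsilon> * t" "0 < \<epsilon>" "0 < l" "0 < arboricity E" "n < 2 ^ l" "e \<in> E"
  shows "2 - \<epsilon> \<le> weight e" "weight e \<le> 2"
proof -
  \<comment> \<open>The loss \<open>l * \<delta>\<close> is then \<open>\<epsilon> / 2\<close> at
    each endpoint, \<open>\<epsilon>\<close> for the whole edge.\<close>
  define \<delta> where "\<delta> = \<epsilon> / (2 * l)"
  have "4 * real (arboricity E) \<le> \<delta> * t"
    using assms(1,3) by (simp add: \<delta>_def field_simps)
  hence hit: "1 - l * \<delta> \<le> hit v" "hit v \<le> 1" if "v \<in> {1..n}" for v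
    using hit_bounds[of \<delta> v] assms that by (auto simp: \<delta>_def)
  have e: "e \<subseteq> {1..n}" "card e = 2" using graph \<open>e \<in> E\<close> by (auto simp: simple_graph_def)
  have "(\<Sum>v\<in>e. 1 - l * \<delta>) \<le> weight e" "weight e \<le> (\<Sum>v\<in>e. 1)"
    unfolding weight_def using e(1) by (intro sum_mono hit; blast)+
  thus "2 - \<epsilon> \<le> weight e" "weight e \<le> 2" using e \<open>0 < l\<close> by (auto simp: \<delta>_def)
qed

end

section \<open>Choice of parameters and final estimates\<close>

theorem theorem1p1:
  "\<exists>(A :: nat \<Rightarrow> nat \<Rightarrow> real \<Rightarrow> nat set query_alg) (C :: real). C > 0 \<and>
     (\<forall>(n :: nat) (m :: nat) (\<alpha> :: nat) (\<epsilon> :: real) (E :: nat set set) (adj :: nat \<Rightarrow> nat list).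
        0 < \<epsilon> \<and> \<epsilon> < 1 \<and> simple_graph {1..n} E \<and> card E = m \<and> m \<ge> 1 \<and>
        arboricity E \<le> \<alpha> \<and> neighbour_ordering E adj \<longrightarrow>
        (let d = 2 * real m / real n in
          (\<exists>U :: nat set pmf.
             output_distribution n E adj (A n \<alpha> \<epsilon>) = spmf_of_pmf U \<and>
             set_pmf U \<subseteq> E \<and>
             pointwise_close E \<epsilon> U (pmf_of_set E)) \<and>
          expected_queries n E adj (A n \<alpha> \<epsilon>)
            \<le> ennreal (C * (real \<alpha> / d * (log 2 (real n) ^ 3 / \<epsilon>)))))"
proof -
  \<comment> \<open>Adding 1 to the rounded logarithm gives the strict bound
    \<open>n < 2 ^ steps n\<close> that empties the core.\<close>
  define steps :: "nat \<Rightarrow> nat" where "steps n = Suc (nat \<lfloor>log 2 (real n)\<rfloor>)" for n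
  \<comment> \<open>This is the least integer satisfying the hypothesis of
    \<open>weight_bounds\<close> with \<open>\<alpha>\<close> in place of the arboricity, which is
    not given to the algorithm.\<close>
  define threshold :: "nat \<Rightarrow> nat \<Rightarrow> real \<Rightarrow> nat" where
    "threshold n \<alpha> \<epsilon> = nat \<lceil>8 * real \<alpha> * real (steps n) / \<epsilon>\<rceil>" for n \<alpha> \<epsilon>
  have main: "(\<exists>U. output_distribution n E adj (sampler (steps n) (threshold n \<alpha> \<epsilon>) Start) =
        spmf_of_pmf U \<and> set_pmf U \<subseteq> E \<and> pointwise_close E \<epsilon> U (pmf_of_set E)) \<and>
      expected_queries n E adj (sampler (steps n) (threshold n \<alpha> \<epsilon>) Start)
        \<le> ennreal (1152 * (real \<alpha> / (2 * real (card E) / real n) * (log 2 (real n) ^ 3 / \<epsilon>)))"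
    if \<epsilon>: "0 < \<epsilon>" "\<epsilon> < 1" and graph: "simple_graph {1..n} E" and m: "1 \<le> card E"
      and \<alpha>: "arboricity E \<le> \<alpha>" and ordering: "neighbour_ordering E adj" for n \<alpha> \<epsilon> E adj
  proof -
    let ?L = "log 2 (real n)" and ?l = "steps n" and ?t = "threshold n \<alpha> \<epsilon>" and ?m = "card E"
    have "finite E" "E \<noteq> {}" using m by (auto simp: card_ge_0_finite)
    hence a: "0 < arboricity E" by (rule arboricity_pos)
    obtain e where "e \<in> E" using \<open>E \<noteq> {}\<close> by blast
    hence "e \<subseteq> {1..n}" "card e = 2" using graph by (auto simp: simple_graph_def)
    \<comment> \<open>Two vertices make the logarithm at least 1, so the added 1 in
      \<open>steps\<close> is absorbed by a factor 2.\<close>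
    hence n: "2 \<le> n" using card_mono[of "{1..n}" e] by simp
    hence L: "1 \<le> ?L" by simp
    have l: "?L < ?l" "?l \<le> 2 * ?L" "1 \<le> real ?l"
      using L unfolding steps_def by linarith+
    have "real n = 2 powr ?L" using n by simp
    also have "\<dots> < 2 powr ?l" using l(1) by simp
    finally have "real n < real (2 ^ ?l)" by (simp add: powr_realpow)
    hence nl: "n < 2 ^ ?l" by (simp only: of_nat_less_iff)
    have "8 * real \<alpha> * ?l / \<epsilon> \<le> ?t" unfolding threshold_def by linarith
    hence "8 * real \<alpha> * ?l \<le> \<epsilon> * ?t" using \<epsilon> by (simp add: pos_divide_le_eq mult.commute)
    moreover have "8 * real (arboricity E) * ?l \<le> 8 * real \<alpha> * ?l"
      using \<alpha> by (intro mult_right_mono) auto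
    ultimately have t: "8 * real (arboricity E) * ?l \<le> \<epsilon> * ?t" by linarith
    \<comment> \<open>This absorbs the rounding of the threshold, turning its factor 8 into 9, and
      makes the threshold positive.\<close>
    have one: "1 \<le> real \<alpha> * ?l / \<epsilon>"
    proof -
      have "1 * 1 \<le> real \<alpha> * ?l" using a \<alpha> l(3) by (intro mult_mono) auto
      thus ?thesis using \<epsilon> by (simp add: pos_le_divide_eq)
    qed
    have t_le: "?t \<le> 9 * (real \<alpha> * ?l / \<epsilon>)"
    proof -
      have "?t \<le> 8 * real \<alpha> * ?l / \<epsilon> + 1"
        using one unfolding threshold_def by linarith
      thus ?thesis using one by simp
    qed
    have "0 < ?t"
      using one unfolding threshold_def by linarith
    then interpret walk n E adj ?l ?t
      using graph ordering n by unfold_locales auto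
    have w: "2 - \<epsilon> \<le> weight e" "weight e \<le> 2" if "e \<in> E" for e
      using weight_bounds[OF t \<epsilon>(1) _ a nl that] l by auto
    let ?W = "\<Sum>e\<in>E. weight e"
    have W: "?m * (2 - \<epsilon>) \<le> ?W" "?W \<le> ?m * 2"
      using sum_mono[of E "\<lambda>_. 2 - \<epsilon>" weight] sum_mono[of E weight "\<lambda>_. 2"] w by auto
    have mW: "real ?m \<le> ?W" "0 < real ?m"
    proof -
      have "real ?m * 1 \<le> ?m * (2 - \<epsilon>)" using \<epsilon> by (intro mult_left_mono) auto
      thus "real ?m \<le> ?W" using W(1) by linarith
    qed (use m in linarith)
    hence "0 < ?W" by linarith
    then obtain U where U: "output_distribution n E adj (sampler ?l ?t Start) = spmf_of_pmf U"
      "set_pmf U \<subseteq> E" "\<And>e. e \<in> E \<Longrightarrow> pmf U e = weight e / ?W"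
      using output_lossless by metis
    have "pointwise_close E \<epsilon> U (pmf_of_set E)"
      unfolding pointwise_close_def
    proof
      fix e assume e: "e \<in> E"
      have "(1 - \<epsilon>) / ?m \<le> weight e / ?W"
      proof -
        have "(1 - \<epsilon>) * ?W \<le> (1 - \<epsilon>) * (?m * 2)" using W(2) \<epsilon> by (intro mult_left_mono) auto
        also have "\<dots> \<le> (2 - \<epsilon>) * ?m" using \<epsilon> mW by (simp add: algebra_simps)
        also have "\<dots> \<le> weight e * ?m" using w(1)[OF e] by (intro mult_right_mono) auto
        finally show ?thesis using \<open>0 < ?W\<close> mW by (simp add: divide_simps mult_ac)
      qed
      moreover have "weight e / ?W \<le> (1 + \<epsilon>) / ?m"
      proof -
        have "weight e * ?m \<le> 2 * real ?m" using w(2)[OF e] by (intro mult_right_mono) auto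
        \<comment> \<open>The product \<open>(1 + \<epsilon>) * (2 - \<epsilon>)\<close> equals
          \<open>2 + \<epsilon> * (1 - \<epsilon>)\<close>.\<close>
        also have "\<dots> \<le> ((1 + \<epsilon>) * (2 - \<epsilon>)) * ?m"
          using \<epsilon> mult_left_mono[of \<epsilon> 1 \<epsilon>] by (intro mult_right_mono) (auto simp: algebra_simps)
        also have "\<dots> = (1 + \<epsilon>) * (?m * (2 - \<epsilon>))" by (simp only: mult_ac)
        also have "\<dots> \<le> (1 + \<epsilon>) * ?W" using W(1) \<epsilon> by (intro mult_left_mono) auto
        finally show ?thesis using \<open>0 < ?W\<close> mW by (simp add: divide_simps mult_ac)
      qed
      ultimately have "\<bar>weight e / ?W - 1 / ?m\<bar> \<le> \<epsilon> * (1 / ?m)"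
        by (simp add: abs_le_iff add_divide_distrib diff_divide_distrib)
      thus "\<bar>pmf U e - pmf (pmf_of_set E) e\<bar> \<le> \<epsilon> * pmf (pmf_of_set E) e"
        using e U(3) \<open>finite E\<close> \<open>E \<noteq> {}\<close> by simp
    qed
    \<comment> \<open>The factors 4, 2 and 9 bound \<open>2 l + 2\<close>, \<open>l + 1\<close> and
      the threshold; 8 comes from \<open>l \<le> 2 * log 2 n\<close> cubed and 2 from the average
      degree, together 1152.\<close>
    moreover have "(2 * real ?l + 2) * ((real ?l + 1) * n * ?t) / ?W
        \<le> 1152 * (real \<alpha> / (2 * real ?m / n) * (?L ^ 3 / \<epsilon>))"
    proof -
      have "(2 * real ?l + 2) * ((real ?l + 1) * n * ?t) / ?W
          \<le> (4 * real ?l) * ((2 * real ?l) * n * (9 * (real \<alpha> * ?l / \<epsilon>))) / ?m"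
        using l(3) t_le mW \<open>0 < ?W\<close> \<epsilon> by (intro frac_le mult_mono) auto
      also have "\<dots> = 72 * real ?l ^ 3 * (real \<alpha> * n / (\<epsilon> * ?m))"
        by (simp add: power3_eq_cube)
      also have "\<dots> \<le> 72 * (2 * ?L) ^ 3 * (real \<alpha> * n / (\<epsilon> * ?m))"
        using l \<epsilon> by (intro mult_right_mono mult_left_mono power_mono) auto
      also have "\<dots> = 1152 * (real \<alpha> / (2 * real ?m / n) * (?L ^ 3 / \<epsilon>))"
        by (simp add: power_mult_distrib)
      finally show ?thesis .
    qed
    ultimately show ?thesis
      using U(1,2) expected_queries_le[OF \<open>0 < ?W\<close>] ennreal_leI by (meson order.trans)
  qed
  show ?thesis
    by (rule exI[of _ "\<lambda>n \<alpha> \<epsilon>. sampler (steps n) (threshold n \<alpha> \<epsilon>) Start"], rule exI[of _ 1152])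
      (use main in \<open>auto simp: Let_def\<close>)
qed

end
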